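(* Let $m\geq 2$ be an integer and let $y_1\leq y_2\leq\cdots\leq y_m$ be integers, all $\geq 2$, with $(y_1,\ldots,y_m)\notin\{(2,2),(2,3)\}$. Then there exist positive integers $k,Y$ such that, with $n=k+m+1$, the $n$-tuple $(\overline{1}_k,y_1,\ldots,y_m,Y)$ lies in $S(n)$. In particular, $$\limsup_{n\to+\infty}\ \max_{(x_1,\ldots,x_n)\in S(n)}|\{x_1,\ldots,x_n\}|=+\infty.$$
   Context: $\sigma_k$ denotes the $k$-th elementary symmetric polynomial in $n$ variables; $\overline{1}_k$ denotes $k$ consecutive entries equal to $1$. $S(n)$ is the set of $n$-tuples $(x_1,\ldots,x_n)$ of positive integers with $x_1\leq\cdots\leq x_n$ and $\sigma_2(x_1,\ldots,x_n)=\sigma_n(x_1,\ldots,x_n)$. $|\{x_1,\ldots,x_n\}|$ is the number of distinct entries. *)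

theory Defs
  imports Complex_Main "HOL-Library.Extended_Real" "HOL-Library.Liminf_Limsup"
begin

text \<open>
  The elementary symmetric polynomial \<open>\<sigma>\<^sub>k\<close> evaluated at a tuple, with the number of
  variables given by the length of the list. The sum runs over sets of positions, so equal entries
  at different positions are counted separately.
\<close>

definition elem_sym :: "nat \<Rightarrow> 'a::comm_semiring_1 list \<Rightarrow> 'a" where
  "elem_sym k xs = (\<Sum>I | I \<subseteq> {..<length xs} \<and> card I = k. \<Prod>i\<in>I. xs ! i)"

definition S :: "nat \<Rightarrow> nat list set" where
  "S n = {xs. length xs = n \<and> (\<forall>x\<in>set xs. 0 < x) \<and> sorted xs \<and> elem_sym 2 xs = elem_sym n xs}"

text \<open>
  \<open>Max\<close> is taken over a finite set, since the values are bounded by \<open>n\<close>. That set is nonempty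
  for every \<open>n \<ge> 2\<close>: \<open>S 2\<close> contains every sorted pair of positive numbers, and for \<open>n = k + 3\<close> the set
  \<open>S n\<close> contains \<open>k\<close> ones followed by \<open>2\<close>, \<open>k + 3\<close> and \<open>\<sigma>\<^sub>2\<close> of the preceding entries. The
  unspecified value of \<open>Max {}\<close> occurs only for \<open>n < 2\<close>.
\<close>

definition max_distinct :: "nat \<Rightarrow> nat" where
  "max_distinct n = Max ((\<lambda>xs. card (set xs)) ` S n)"

end

(*
  Write s and P for the sum and the product of the y_i and put k = P - s - 1. This is the choice
  for which the equation sigma_2 = sigma_n, linear in the last entry Y, has leading coefficient
  P - k - s = 1, so that Y = sigma_2(1,...,1,y_1,...,y_m) solves it. The condition k > 0 amounts to
  P >= s + 2, which fails only for (2,2) and (2,3). Taking 2, 3, ..., m + 1 for the y_i makes the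
  number of distinct entries unbounded.
*)
theory Submission
  imports Defs
begin

lemma elem_sym_0 [simp]: "elem_sym 0 xs = 1"
proof -
  have "{I. I \<subseteq> {..<length xs} \<and> card I = 0} = {{}}"
    by (auto dest: finite_subset)
  then show ?thesis by (simp add: elem_sym_def)
qed

lemma elem_sym_Suc_Nil [simp]: "elem_sym (Suc k) [] = 0"
  unfolding elem_sym_def by (rule sum.neutral) auto

lemma elem_sym_length: "elem_sym (length xs) xs = prod_list xs"
proof -
  have "{I. I \<subseteq> {..<length xs} \<and> card I = length xs} = {{..<length xs}}"
    using card_subset_eq[of "{..<length xs}"] by auto
  then show ?thesis
    by (simp add: elem_sym_def prod.list_conv_set_nth atLeast0LessThan)
qed

text \<open>Position sets are split by whether they contain position 0, and tail positions are
  shifted by \<open>Suc\<close>. With this recursion, \<sigma>_1 and \<sigma>_2 can be computed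
  along the list, without returning to position sets.\<close>

lemma elem_sym_Suc_Cons [simp]:
  "elem_sym (Suc k) (x # xs) = x * elem_sym k xs + elem_sym (Suc k) xs"
proof -
  let ?N = "\<lambda>k. {I. I \<subseteq> {..<length xs} \<and> card I = k}"
  let ?with = "\<lambda>I. insert 0 (Suc ` I)"
  let ?g = "\<lambda>I. \<Prod>i\<in>I. (x # xs) ! i"
  have finN: "finite (?N k)" for k
    by (rule finite_subset[of _ "Pow {..<length xs}"]) auto
  have fin: "finite I" if "I \<in> ?N k" for I k
    using that finite_subset by blast
  have split: "{I. I \<subseteq> {..<length (x # xs)} \<and> card I = Suc k}
      = ?with ` ?N k \<union> (`) Suc ` ?N (Suc k)" (is "?L = ?R")
  proof
    show "?L \<subseteq> ?R"
    proof
      fix I assume I: "I \<in> ?L"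
      then have finI: "finite I" using finite_subset by blast
      \<comment> \<open>\<open>J\<close> holds the nonzero positions of \<open>I\<close>, renumbered
        as positions of the tail; it is smaller than \<open>I\<close> by one exactly when 0 lies in
        \<open>I\<close>.\<close>
      define J where "J = {i. Suc i \<in> I}"
      have img: "Suc ` J = I - {0}"
        by (auto simp: J_def image_iff gr0_conv_Suc) (metis not0_implies_Suc)
      have J: "J \<subseteq> {..<length xs}" using I by (auto simp: J_def)
      have card: "card J = card (I - {0})"
        by (metis card_image img inj_Suc inj_on_subset subset_UNIV)
      show "I \<in> ?R"
      proof (cases "0 \<in> I")
        case True
        then have "J \<in> ?N k" "I = ?with J" using I J card finI img by auto
        then show ?thesis by blast
      next
        case False
        then have "J \<in> ?N (Suc k)" "I = Suc ` J" using I J card img by auto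
        then show ?thesis by blast
      qed
    qed
    show "?R \<subseteq> ?L"
      using fin by (auto simp: card_image card_insert_if)
  qed
  have inj_with: "inj_on ?with (?N k)"
  proof (rule inj_onI)
    fix I J :: "nat set" assume "?with I = ?with J"
    then have "Suc ` I = Suc ` J" by auto
    then show "I = J" by (simp add: inj_image_eq_iff)
  qed
  have inj_without: "inj_on ((`) Suc) (?N (Suc k))"
    by (rule inj_onI) (simp add: inj_image_eq_iff)
  have "elem_sym (Suc k) (x # xs) = (\<Sum>I\<in>?with ` ?N k. ?g I) + (\<Sum>I\<in>(`) Suc ` ?N (Suc k). ?g I)"
    unfolding elem_sym_def split by (rule sum.union_disjoint) (use finN in auto)
  also have "(\<Sum>I\<in>?with ` ?N k. ?g I) = (\<Sum>I\<in>?N k. x * (\<Prod>i\<in>I. xs ! i))"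
    unfolding sum.reindex[OF inj_with] using fin
    by (intro sum.cong) (auto simp: prod.reindex)
  also have "\<dots> = x * elem_sym k xs"
    by (simp add: elem_sym_def sum_distrib_left)
  also have "(\<Sum>I\<in>(`) Suc ` ?N (Suc k). ?g I) = elem_sym (Suc k) xs"
    unfolding sum.reindex[OF inj_without] elem_sym_def
    by (intro sum.cong) (auto simp: prod.reindex)
  finally show ?thesis .
qed

lemma elem_sym_1: "elem_sym (Suc 0) xs = sum_list xs"
  by (induction xs) auto

lemma elem_sym_2_Cons: "elem_sym 2 (x # xs) = x * sum_list xs + elem_sym 2 xs"
  by (simp add: numeral_2_eq_2 elem_sym_1)

text \<open>Two positions lie both in the first list, both in the second, or one in each; the mixed
  pairs contribute the product of the sums.\<close>

lemma elem_sym_2_append: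
  "elem_sym 2 (xs @ ys) = elem_sym 2 xs + elem_sym 2 ys + sum_list xs * sum_list ys"
proof (induction xs)
  case Nil
  then show ?case by (simp add: numeral_2_eq_2)
next
  case (Cons x xs)
  then show ?case by (simp add: elem_sym_2_Cons algebra_simps)
qed

lemma elem_sym_2_singleton: "elem_sym 2 [x] = 0"
  by (simp add: numeral_2_eq_2)

text \<open>Needed for sortedness: the last entry \<open>Y\<close> has to dominate all others. One
  part of \<sigma>_2 is the head times the sum of the tail; both factors are positive, and each
  entry is bounded by one of them.\<close>

lemma member_le_elem_sym_2:
  fixes ys :: "nat list"
  assumes "2 \<le> length ys" "\<forall>y\<in>set ys. 0 < y" "y \<in> set ys"
  shows "y \<le> elem_sym 2 ys"
proof -
  obtain x z zs where ys: "ys = x # z # zs"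
    using assms(1) by (auto simp: numeral_2_eq_2 Suc_le_length_iff)
  let ?t = "sum_list (z # zs)"
  have "0 < x" "0 < ?t" using assms(2) ys by auto
  moreover have "y = x \<or> y \<le> ?t"
    using assms(3) ys member_le_sum_list[of y "z # zs"] by auto
  ultimately have "y \<le> x * ?t"
    by (auto intro: order_trans[of y ?t "x * ?t"] simp del: sum_list.Cons)
  then show ?thesis by (simp only: ys elem_sym_2_Cons)
qed

text \<open>Equivalent to (p - 1)(y - 1) \<ge> 3. It controls how sum and product change when an
  entry \<open>y\<close> is put before a list with product \<open>p\<close>.\<close>

lemma mult_ge_add_2:
  fixes p y :: nat
  assumes "4 \<le> p" "2 \<le> y"
  shows "p + y + 2 \<le> y * p"
proof -
  obtain a b where "p = a + 4" "y = b + 2"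
    using assms by (metis le_add_diff_inverse2)
  then show ?thesis by (simp add: algebra_simps)
qed

text \<open>Without the extra 2 the bound also holds for (2,2) and (2,3), so the induction has no
  exceptional cases. The bound 4 is carried along because prepending an entry requires it.\<close>

lemma sum_list_le_prod_list:
  fixes ys :: "nat list"
  assumes "2 \<le> length ys" "\<forall>y\<in>set ys. 2 \<le> y"
  shows "sum_list ys \<le> prod_list ys \<and> 4 \<le> prod_list ys"
  using assms
proof (induction ys)
  case Nil
  then show ?case by simp
next
  case (Cons x xs)
  show ?case
  proof (cases "2 \<le> length xs")
    case True
    then have "sum_list xs \<le> prod_list xs" "4 \<le> prod_list xs" using Cons by auto
    then show ?thesis using mult_ge_add_2[of "prod_list xs" x] Cons.prems by auto
  next
    case False
    then obtain z where xs: "xs = [z]"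
      using Cons.prems by (cases xs) (auto simp: Suc_le_eq)
    obtain a b where "x = a + 2" "z = b + 2"
      using Cons.prems xs by (metis le_add_diff_inverse2 list.set_intros(1,2))
    then show ?thesis using xs by (simp add: algebra_simps)
  qed
qed

lemma sum_list_add_2_le_prod_list:
  fixes ys :: "nat list"
  assumes len: "2 \<le> length ys" and ge: "\<forall>y\<in>set ys. 2 \<le> y" and "sorted ys"
    and ne: "ys \<notin> {[2, 2], [2, 3]}"
  shows "sum_list ys + 2 \<le> prod_list ys"
proof -
  obtain x xs where ys: "ys = x # xs" using len by (cases ys) auto
  show ?thesis
  proof (cases "2 \<le> length xs")
    case True
    then have "sum_list xs \<le> prod_list xs" "4 \<le> prod_list xs"
      using sum_list_le_prod_list ge ys by auto
    \<comment> \<open>Prepending \<open>x\<close> to a list satisfying the weak bound gains the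
      missing 2, so exceptions can occur only among pairs.\<close>
    then show ?thesis using mult_ge_add_2[of "prod_list xs" x] ge ys by auto
  next
    case False
    then obtain z where xs: "xs = [z]"
      using len ys by (cases xs) (auto simp: Suc_le_eq)
    have xz: "2 \<le> x" "x \<le> z" using ge \<open>sorted ys\<close> ys xs by auto
    show ?thesis
    \<comment> \<open>For a pair the claim reads (x - 1)(z - 1) \<ge> 3. If x = 2 it needs z \<ge>
      4; otherwise sortedness gives z \<ge> 3 as well.\<close>
    proof (cases "x = 2")
      case True
      then have "4 \<le> z" using ne ys xs xz by auto
      then show ?thesis using True ys xs by simp
    next
      case False
      then have "3 \<le> x" "3 \<le> z" using xz by auto
      then obtain a b where "x = a + 3" "z = b + 3"
        by (metis le_add_diff_inverse2)
      then show ?thesis using ys xs by (simp add: algebra_simps)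
    qed
  qed
qed

lemma replicate_append_in_S:
  fixes ys :: "nat list"
  assumes len: "2 \<le> length ys" and ge: "\<forall>y\<in>set ys. 2 \<le> y" and sorted: "sorted ys"
    and ne: "ys \<notin> {[2, 2], [2, 3]}"
  shows "\<exists>k Y. 0 < k \<and> 0 < Y \<and> replicate k 1 @ ys @ [Y] \<in> S (k + length ys + 1)"
proof -
  define k where "k = prod_list ys - sum_list ys - 1"
  \<comment> \<open>The product exceeds the sum by at least 2, so the natural subtractions in
    \<open>k\<close> do not truncate.\<close>
  have P: "prod_list ys = k + sum_list ys + 1" and k: "0 < k"
    using sum_list_add_2_le_prod_list[OF assms] by (simp_all add: k_def)
  define Y where "Y = elem_sym 2 (replicate k 1 @ ys)"
  have Y_ge: "y \<le> Y" if "y \<in> set ys" for y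
  proof -
    have "y \<le> elem_sym 2 ys"
      using member_le_elem_sym_2[OF len _ that] ge by (metis less_le_trans pos2)
    then show ?thesis by (simp add: Y_def elem_sym_2_append)
  qed
  have "hd ys \<in> set ys" using len by (cases ys) auto
  then have "2 \<le> hd ys" "hd ys \<le> Y" using ge Y_ge by auto
  then have Y: "1 < Y" by simp
  let ?xs = "(replicate k 1 @ ys) @ [Y]"
  have "elem_sym 2 ?xs = Y + (k + sum_list ys) * Y"
    \<comment> \<open>The prefix has \<sigma>_2 equal to \<open>Y\<close> and sum
      \<open>k + sum_list ys\<close>; the total is \<open>Y\<close> times one more than that sum,
      which is \<open>Y * prod_list ys\<close> by \<open>P\<close>.\<close>
    unfolding elem_sym_2_append[of "replicate k 1 @ ys"]
    by (simp add: elem_sym_2_singleton Y_def sum_list_replicate)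
  also have "\<dots> = elem_sym (length ?xs) ?xs"
    by (simp add: elem_sym_length P algebra_simps del: length_append)
  finally have "elem_sym 2 ?xs = elem_sym (k + length ys + 1) ?xs" by simp
  moreover have "sorted ?xs" using sorted Y_ge Y ge by (force simp: sorted_append)
  moreover have "\<forall>x\<in>set ?xs. 0 < x" using Y ge by force
  moreover have "length ?xs = k + length ys + 1" by simp
  ultimately have "?xs \<in> S (k + length ys + 1)" unfolding S_def by blast
  then show ?thesis using k Y by (intro exI[of _ k] exI[of _ Y]) auto
qed

lemma card_set_le_max_distinct:
  assumes "xs \<in> S n"
  shows "card (set xs) \<le> max_distinct n"
proof -
  \<comment> \<open>\<open>S n\<close> itself may be infinite, as for n = 2; only the set of counts
    is finite.\<close>
  have "(\<lambda>xs. card (set xs)) ` S n \<subseteq> {..n}"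
    by (auto simp: S_def card_length)
  then show ?thesis
    unfolding max_distinct_def using assms
    by (intro Max_ge) (auto intro: finite_subset)
qed

lemma ex_max_distinct_ge: "\<exists>n\<ge>m. m \<le> max_distinct n"
proof -
  \<comment> \<open>The entries 2, ..., m + 4 number at least three even for m = 0, which rules out
    the exceptional pairs.\<close>
  let ?ys = "[2..<m + 5]"
  have "length ?ys = m + 3" by simp
  then have "?ys \<notin> {[2, 2], [2, 3]}"
    by (auto dest!: arg_cong[of _ _ length] simp del: upt_Suc)
  then obtain k Y where xs: "replicate k 1 @ ?ys @ [Y] \<in> S (k + length ?ys + 1)"
    using replicate_append_in_S[of ?ys] by auto
  have "m \<le> card (set ?ys)" by simp
  also have "\<dots> \<le> card (set (replicate k 1 @ ?ys @ [Y]))"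
    by (rule card_mono) auto
  also have "\<dots> \<le> max_distinct (k + length ?ys + 1)"
    using xs by (rule card_set_le_max_distinct)
  finally show ?thesis by (intro exI[of _ "k + length ?ys + 1"]) simp
qed

theorem theorem4p6:
  "(\<forall>(m::nat) (ys::nat list).
      2 \<le> m \<and> length ys = m \<and> sorted ys \<and> (\<forall>y\<in>set ys. 2 \<le> y) \<and> ys \<notin> {[2, 2], [2, 3]} \<longrightarrow>
      (\<exists>k Y. 0 < k \<and> 0 < Y \<and> replicate k 1 @ ys @ [Y] \<in> S (k + m + 1)))
   \<and> limsup (\<lambda>n. ereal (real (max_distinct n))) = \<infinity>"
proof (intro conjI allI impI)
  fix m :: nat and ys :: "nat list"
  assume "2 \<le> m \<and> length ys = m \<and> sorted ys \<and> (\<forall>y\<in>set ys. 2 \<le> y) \<and> ys \<notin> {[2, 2], [2, 3]}"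
  then show "\<exists>k Y. 0 < k \<and> 0 < Y \<and> replicate k 1 @ ys @ [Y] \<in> S (k + m + 1)"
    using replicate_append_in_S[of ys] by blast
next
  have "ereal (real b) \<le> limsup (\<lambda>n. ereal (real (max_distinct n)))" for b :: nat
    unfolding limsup_INF_SUP
  proof (rule INF_greatest)
    fix N :: nat
    \<comment> \<open>Taking the maximum puts the index beyond \<open>N\<close> and the value above
      \<open>b\<close> at once.\<close>
    obtain n where "max b N \<le> n" "max b N \<le> max_distinct n"
      using ex_max_distinct_ge by blast
    then show "ereal (real b) \<le> (SUP n\<in>{N..}. ereal (real (max_distinct n)))"
      by (intro SUP_upper2[of n]) auto
  qed
  then show "limsup (\<lambda>n. ereal (real (max_distinct n))) = \<infinity>"
    by (intro ereal_top) (meson ereal_less_eq(3) order_trans real_arch_simple)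
qed

end
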